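(* For $d\ge 2$ let $\mathcal L:M(d,d)\to\mathbb R$ be $\mathcal L(W)=\big\|\sum_{i=1}^d w_i^{\otimes 3}-\sum_{i=1}^d e_i^{\otimes 3}\big\|_F^2$, where $w_1,\dots,w_d$ are the rows of $W$, and for $t\in\mathbb R$ let $$\mathfrak C_{5,t}(d)=I_{d-2}\oplus\begin{bmatrix}(1-t^3)^{1/3}&0\\ t&0\end{bmatrix}\in M(d,d),$$ with $(\cdot)^{1/3}$ the real cube root. Then for all $t\in\mathbb R$ and $d\ge 2$, $\mathfrak C_{5,t}(d)$ is a critical point of $\mathcal L$ and $\mathcal L(\mathfrak C_{5,t}(d))=1$. In particular, the level set $\mathcal L^{-1}(\{1\})$ is not bounded, and so $\mathcal L$ is not a proper map.
   Context: $M(d,d)$ is the space of real $d\times d$ matrices, $e_i$ is the $i$-th unit vector of $\mathbb R^d$, $\oplus$ denotes block-diagonal sum of matrices, and $\|T\|_F^2=\sum_{i,j,k}T_{ijk}^2$ for order-$3$ tensors. A map is proper if preimages of compact sets are compact. *)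

theory Defs
  imports "HOL-Analysis.Analysis" "Jordan_Normal_Form.Matrix"
begin

no_notation vec_index (infixl "$" 100)

definition tensor_cube :: "real ^ 'd \<Rightarrow> real ^ 'd ^ 'd ^ 'd" where
  "tensor_cube w = (\<chi> i j k. w $ i * w $ j * w $ k)"

definition frobenius_norm :: "real ^ 'd ^ 'd ^ 'd \<Rightarrow> real" where
  "frobenius_norm T = sqrt (\<Sum>i\<in>UNIV. \<Sum>j\<in>UNIV. \<Sum>k\<in>UNIV. (T $ i $ j $ k)\<^sup>2)"

definition loss :: "real ^ 'd ^ 'd \<Rightarrow> real" where
  "loss W = (frobenius_norm
     ((\<Sum>i\<in>UNIV. tensor_cube (Finite_Cartesian_Product.row i W)) - (\<Sum>i\<in>UNIV. tensor_cube (axis i 1))))\<^sup>2"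

text \<open>The matrices with rows and columns numbered \<open>0, \<dots>, d - 1\<close> are transported to the index type
  \<open>'d\<close> by a numbering \<open>\<nu>\<close>, which is meant to be a bijection from \<open>'d\<close> onto \<open>{..<CARD('d)}\<close>.\<close>

definition index_by :: "('d \<Rightarrow> nat) \<Rightarrow> real mat \<Rightarrow> real ^ 'd ^ 'd" where
  "index_by \<nu> A = (\<chi> i j. A $$ (\<nu> i, \<nu> j))"

text \<open>\<^const>\<open>root\<close> is odd in its second argument, so \<^term>\<open>root 3\<close> is the real cube root on the whole line.\<close>

definition C5_mat :: "nat \<Rightarrow> real \<Rightarrow> real mat" where
  "C5_mat d t = diag_block_mat
     [1\<^sub>m (d - 2), mat_of_rows_list 2 [[root 3 (1 - t ^ 3), 0], [t, 0]]]"

definition critical_point :: "('a::real_normed_vector \<Rightarrow> real) \<Rightarrow> 'a \<Rightarrow> bool" where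
  "critical_point f x \<longleftrightarrow> (f has_derivative (\<lambda>h. 0)) (at x)"

text \<open>Properness through preimages of compact sets, rather than through closedness and compact
  fibres as in \<^const>\<open>proper_map\<close>.\<close>

definition compact_proper :: "('a::topological_space \<Rightarrow> 'b::topological_space) \<Rightarrow> bool" where
  "compact_proper f \<longleftrightarrow> (\<forall>K. compact K \<longrightarrow> compact (f -` K))"

end

theory Submission imports Defs begin

text \<open>Write \<open>q\<close> for the last index. Both nonzero entries of the \<open>2 \<times> 2\<close> block lie in its first
  column and their cubes sum to \<open>1\<close>, so the residual tensor at \<^term>\<open>C5_mat d t\<close> is
  \<open>- e\<^sub>q\<otimes>e\<^sub>q\<otimes>e\<^sub>q\<close>, of norm \<open>1\<close>. The only residual entry with nonzero value is
  \<open>\<Sum>\<^sub>i W\<^sub>i\<^sub>q\<^sup>3 - 1\<close>, whose derivative \<open>3 \<Sum>\<^sub>i W\<^sub>i\<^sub>q\<^sup>2 H\<^sub>i\<^sub>q\<close> vanishes because column \<open>q\<close> is zero.\<close>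

text \<open>The entry at \<open>(a, b, c)\<close> of the difference tensor inside
  \<open>loss\<close>; the \<open>of_bool\<close> term is that entry of the sum of the cubes of the
  unit vectors.\<close>

definition residual :: "'d \<Rightarrow> 'd \<Rightarrow> 'd \<Rightarrow> real ^ 'd ^ 'd \<Rightarrow> real" where
  "residual a b c W = (\<Sum>i\<in>UNIV. W $ i $ a * W $ i $ b * W $ i $ c) - of_bool (a = b \<and> b = c)"

text \<open>The outer square cancels the root in \<open>frobenius_norm\<close>, leaving a polynomial
  in the entries that can be differentiated term by term.\<close>

lemma loss_eq_sum_residual:
  fixes W :: "real ^ 'd ^ 'd"
  shows "loss W = (\<Sum>a\<in>UNIV. \<Sum>b\<in>UNIV. \<Sum>c\<in>UNIV. (residual a b c W)\<^sup>2)"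
proof -
  have "(\<Sum>i\<in>UNIV. axis i (1::real) $ a * axis i 1 $ b * axis i 1 $ c) = of_bool (a = b \<and> b = c)"
    for a b c :: 'd
  proof -
    have "(\<Sum>i\<in>UNIV. axis i (1::real) $ a * axis i 1 $ b * axis i 1 $ c)
        = (\<Sum>i\<in>UNIV. if i = a then of_bool (a = b \<and> b = c) else 0)"
      by (rule sum.cong) (auto simp: axis_def)
    then show ?thesis by simp
  qed
  then show ?thesis
    by (simp add: loss_def frobenius_norm_def tensor_cube_def residual_def
        Finite_Cartesian_Product.row_def sum_nonneg)
qed

lemma residual_has_derivative:
  fixes W :: "real ^ 'd ^ 'd"
  shows "(residual a b c has_derivative (\<lambda>H. \<Sum>i\<in>UNIV.
      W $ i $ a * W $ i $ b * H $ i $ c + (W $ i $ a * H $ i $ b + H $ i $ a * W $ i $ b) * W $ i $ c)) (at W)"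
proof -
  have entry: "((\<lambda>W. W $ i $ j) has_derivative (\<lambda>H. H $ i $ j)) (at W)" for i j
    by (intro bounded_linear_imp_has_derivative
        bounded_linear_compose[OF bounded_linear_vec_nth bounded_linear_vec_nth])
  show ?thesis
    unfolding residual_def
    by (rule derivative_eq_intros entry refl | simp)+
qed

text \<open>Only the residual tensor and one zero column enter here, which keeps the cube root and
  the numbering out of the calculus.\<close>

lemma loss_critical:
  fixes W :: "real ^ 'd ^ 'd"
  assumes res: "\<And>a b c. residual a b c W = - of_bool (a = q \<and> b = q \<and> c = q)"
    and col: "\<And>i. W $ i $ q = 0"
  shows "critical_point loss W" and "loss W = 1"
proof -
  have "((\<lambda>W. (residual a b c W)\<^sup>2) has_derivative (\<lambda>H. 0)) (at W)" for a b c
  proof -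
    have "((\<lambda>W. (residual a b c W)\<^sup>2) has_derivative (\<lambda>H. 2 * residual a b c W * (\<Sum>i\<in>UNIV.
      W $ i $ a * W $ i $ b * H $ i $ c + (W $ i $ a * H $ i $ b + H $ i $ a * W $ i $ b) * W $ i $ c))) (at W)"
      by (rule derivative_eq_intros residual_has_derivative refl | simp add: ac_simps)+
    \<comment> \<open>Away from \<open>(q, q, q)\<close> the residual factor is zero; at
      \<open>(q, q, q)\<close> every summand contains an entry of the zero column.\<close>
    moreover have "2 * residual a b c W * (\<Sum>i\<in>UNIV. W $ i $ a * W $ i $ b * H $ i $ c +
        (W $ i $ a * H $ i $ b + H $ i $ a * W $ i $ b) * W $ i $ c) = 0" for H
      by (cases "a = q \<and> b = q \<and> c = q") (auto simp: res col)
    ultimately show ?thesis by simp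
  qed
  then have "((\<lambda>W. \<Sum>a\<in>UNIV. \<Sum>b\<in>UNIV. \<Sum>c\<in>UNIV. (residual a b c W)\<^sup>2) has_derivative
      (\<lambda>H. \<Sum>a\<in>(UNIV::'d set). \<Sum>b\<in>(UNIV::'d set). \<Sum>c\<in>(UNIV::'d set). 0)) (at W)"
    by (intro has_derivative_sum)
  then show "critical_point loss W"
    by (simp add: critical_point_def loss_eq_sum_residual[abs_def])
  \<comment> \<open>The conditional on a single index lets the three sums collapse one at a
    time.\<close>
  have "(residual a b c W)\<^sup>2 = (if c = q then of_bool (a = q \<and> b = q) else 0)" for a b c
    by (simp add: res)
  then have "(\<Sum>c\<in>UNIV. (residual a b c W)\<^sup>2) = (if b = q then of_bool (a = q) else 0)" for a b
    by simp
  then have "(\<Sum>b\<in>UNIV. \<Sum>c\<in>UNIV. (residual a b c W)\<^sup>2) = (if a = q then 1 else 0)" for a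
    by simp
  then show "loss W = 1"
    by (simp add: loss_eq_sum_residual)
qed

lemma C5_mat_index:
  assumes "2 \<le> d" "i < d" "j < d"
  shows "C5_mat d t $$ (i, j) =
    (if i < d - 2 then of_bool (i = j)
     else if j = d - 2 then if i = d - 2 then root 3 (1 - t ^ 3) else t
     else 0)"
proof -
  \<comment> \<open>With \<open>d = k + 2\<close> the truncated subtraction disappears and each
    index is either in the identity block or one of two explicit positions.\<close>
  obtain k where d: "d = Suc (Suc k)"
    using assms(1) by (metis add_2_eq_Suc le_Suc_ex)
  have "i < k \<or> i = k \<or> i = Suc k" and "j < k \<or> j = k \<or> j = Suc k"
    using assms d by linarith+
  then show ?thesis
    by (elim disjE) (simp_all add: d C5_mat_def mat_of_rows_list_def Let_def)
qed

theorem proposition2: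
  assumes "CARD('d::finite) \<ge> 2"
  shows "(\<forall>(\<nu> :: 'd \<Rightarrow> nat) (t::real). bij_betw \<nu> UNIV {..<CARD('d)} \<longrightarrow>
            critical_point loss (index_by \<nu> (C5_mat CARD('d) t)) \<and>
            loss (index_by \<nu> (C5_mat CARD('d) t)) = 1) \<and>
         \<not> bounded ((loss :: real ^ 'd ^ 'd \<Rightarrow> real) -` {1}) \<and>
         \<not> compact_proper (loss :: real ^ 'd ^ 'd \<Rightarrow> real)"
proof -
  let ?W = "\<lambda>(\<nu> :: 'd \<Rightarrow> nat) t. index_by \<nu> (C5_mat CARD('d) t)"
  have crit: "critical_point loss (?W \<nu> t)" "loss (?W \<nu> t) = 1" and large: "\<bar>t\<bar> \<le> norm (?W \<nu> t)"
    if \<nu>: "bij_betw \<nu> UNIV {..<CARD('d)}" for \<nu> t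
  proof -
    have inj: "\<nu> i = \<nu> j \<longleftrightarrow> i = j" for i j
      using \<nu> by (auto simp: bij_betw_def inj_eq)
    have less: "\<nu> i < CARD('d)" for i
      using \<nu> by (auto simp: bij_betw_def)
    \<comment> \<open>The two indices of the last block: column \<open>p\<close> carries the cube
      root and \<open>t\<close>, column \<open>q\<close> is zero.\<close>
    obtain p q where p: "\<nu> p = CARD('d) - 2" and q: "\<nu> q = CARD('d) - 1"
    proof -
      have "CARD('d) - 2 \<in> \<nu> ` UNIV" "CARD('d) - 1 \<in> \<nu> ` UNIV"
        using \<nu> assms by (auto simp: bij_betw_def)
      then show thesis using that by (metis imageE)
    qed
    have pq: "p \<noteq> q" using p q assms by auto
    have less_iff: "\<nu> i < CARD('d) - 2 \<longleftrightarrow> i \<noteq> p \<and> i \<noteq> q" for i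
      using less[of i] inj[of i p] inj[of i q] p q assms by linarith
    have W: "?W \<nu> t $ i $ j = (if i = p then of_bool (j = p) * root 3 (1 - t ^ 3)
        else if i = q then of_bool (j = p) * t else of_bool (i = j))" for i j
      using less_iff[of i] inj[of j p] inj[of i p] pq
      by (auto simp: index_by_def C5_mat_index[OF assms less less] inj p)
    show "\<bar>t\<bar> \<le> norm (?W \<nu> t)"
    proof -
      have "\<bar>?W \<nu> t $ q $ p\<bar> \<le> norm (?W \<nu> t $ q)" by (rule component_le_norm_cart)
      also have "\<dots> \<le> norm (?W \<nu> t)" by (rule Finite_Cartesian_Product.norm_nth_le)
      finally show ?thesis using pq by (simp add: W)
    qed
    have col: "?W \<nu> t $ i $ q = 0" for i
      using pq by (auto simp: W)
    \<comment> \<open>An odd root inverts the cube for either sign of \<open>1 - t ^ 3\<close>, so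
      \<open>t\<close> may exceed 1.\<close>
    have cube: "root 3 (1 - t ^ 3) * root 3 (1 - t ^ 3) * root 3 (1 - t ^ 3) = 1 - t ^ 3"
      using odd_real_root_pow[of 3 "1 - t ^ 3"] by (simp add: power3_eq_cube)
    have res: "residual a b c (?W \<nu> t) = - of_bool (a = q \<and> b = q \<and> c = q)" for a b c
    proof -
      \<comment> \<open>Rows \<open>p\<close> and \<open>q\<close> are multiples of the unit vector
        at \<open>p\<close>, with cubes adding up to 1. Any other row is its own unit vector and
        contributes only when \<open>i = a\<close>.\<close>
      have "(\<Sum>i\<in>UNIV. ?W \<nu> t $ i $ a * ?W \<nu> t $ i $ b * ?W \<nu> t $ i $ c)
        = (\<Sum>i\<in>UNIV. (if i = p then of_bool (a = p \<and> b = p \<and> c = p) * (1 - t ^ 3) else 0)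
          + (if i = q then of_bool (a = p \<and> b = p \<and> c = p) * t ^ 3 else 0)
          + (if i = a then of_bool (a \<noteq> p \<and> a \<noteq> q \<and> a = b \<and> b = c) else 0))"
        using pq by (intro sum.cong) (auto simp: W cube[unfolded power3_eq_cube] power3_eq_cube)
      also have "\<dots> = of_bool (a = p \<and> b = p \<and> c = p)
          + of_bool (a \<noteq> p \<and> a \<noteq> q \<and> a = b \<and> b = c)"
        by (simp add: sum.distrib)
      finally show ?thesis
        using pq by (auto simp: residual_def)
    qed
    show "critical_point loss (?W \<nu> t)" "loss (?W \<nu> t) = 1"
      using loss_critical[OF res col] by auto
  qed
  obtain \<nu> :: "'d \<Rightarrow> nat" where \<nu>: "bij_betw \<nu> UNIV {..<CARD('d)}"
    using ex_bij_betw_finite_nat[of "UNIV :: 'd set"] by (auto simp: atLeast0LessThan)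
  have unbounded: "\<not> bounded ((loss :: real ^ 'd ^ 'd \<Rightarrow> real) -` {1})"
  proof
    assume "bounded ((loss :: real ^ 'd ^ 'd \<Rightarrow> real) -` {1})"
    then obtain B where "\<And>W :: real ^ 'd ^ 'd. loss W = 1 \<Longrightarrow> norm W \<le> B"
      by (auto simp: bounded_iff)
    \<comment> \<open>The entry \<open>t\<close> bounds the norm from below, so
      \<open>t = \<bar>B\<bar> + 1\<close> exceeds any proposed bound \<open>B\<close>.\<close>
    then have "norm (?W \<nu> (\<bar>B\<bar> + 1)) \<le> B"
      using crit(2)[OF \<nu>] by blast
    with large[OF \<nu>, of "\<bar>B\<bar> + 1"] show False by linarith
  qed
  then have "\<not> compact_proper (loss :: real ^ 'd ^ 'd \<Rightarrow> real)"
    unfolding compact_proper_def using compact_imp_bounded compact_sing by blast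
  with crit unbounded show ?thesis by blast
qed

end
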